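(* The set $\mathbf{O'}=\{K : \mathbf{NP}^K\neq\mathbf{coNP}^K\}$ is Ramsey positive. Moreover, there exists an infinite set $H\subseteq\omega$ such that for every infinite oracle $K\subseteq H$, $\mathbf{NP}^K\neq\mathbf{coNP}^K$.
   Context: Binary strings are identified with natural numbers via a fixed effective enumeration of $\{0,1\}^{<\omega}$, so that infinite oracles (infinite sets of binary strings) are identified with elements of $[\omega]^\omega$, the set of infinite subsets of $\omega$. $\mathbf{NP}^K$ and $\mathbf{coNP}^K$ are the relativized classes. The Ellentuck topology on $[\omega]^\omega$ has as basic open sets $[a,A]=\{S\in[\omega]^\omega : S\cap(\max a+1)=a,\ S\setminus a\subseteq A\}$ for finite $a\subseteq\omega$ and infinite $A\subseteq\omega$ with $\min A>\max a$. A set $S\subseteq[\omega]^\omega$ is Ramsey small if it is meager in the Ellentuck topology, Ramsey large if it is comeager in it, and Ramsey positive if it is not Ramsey small. *)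

theory Defs
  imports "HOL-Analysis.Analysis" "HOL-Computational_Algebra.Polynomial"
begin

section \<open>Binary strings as natural numbers\<close>

text \<open>The shortlex enumeration (empty, 0, 1, 00, 01, 10, 11, 000, \dots):
  \<open>nat_of_str w\<close> is the position of \<open>w\<close>, i.e. the number with binary expansion \<open>1w\<close>, minus 1.\<close>

definition nat_of_str :: "bool list \<Rightarrow> nat" where
  "nat_of_str w = foldl (\<lambda>n b. 2 * n + (if b then 2 else 1)) 0 w"

lemma nat_of_str_Nil [simp]: "nat_of_str [] = 0"
  by (simp add: nat_of_str_def)

lemma nat_of_str_snoc [simp]:
  "nat_of_str (w @ [b]) = 2 * nat_of_str w + (if b then 2 else 1)"
  by (simp add: nat_of_str_def)

lemma nat_of_str_eq_0_iff [simp]: "nat_of_str w = 0 \<longleftrightarrow> w = []"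
  by (cases w rule: rev_cases) simp_all

lemma bij_nat_of_str: "bij nat_of_str"
proof (rule bijI)
  have digit: "a = b \<and> m = n"
    if "2 * m + (if a then 2 else 1) = 2 * n + (if b then 2 else 1)" for m n :: nat and a b
    using that by (auto split: if_splits dest: arg_cong[of _ _ even])
  have "nat_of_str v = nat_of_str w \<Longrightarrow> v = w" for v w
  proof (induction v arbitrary: w rule: rev_induct)
    case Nil
    then show ?case by (metis nat_of_str_Nil nat_of_str_eq_0_iff)
  next
    case (snoc b v)
    have "w \<noteq> []" using snoc.prems by (auto split: if_splits)
    then obtain w' b' where w: "w = w' @ [b']" by (metis rev_exhaust)
    then have "b = b' \<and> nat_of_str v = nat_of_str w'"
      using digit snoc.prems by (metis nat_of_str_snoc)
    then show ?case using w snoc.IH by blast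
  qed
  then show "inj nat_of_str" by (rule injI)
next
  have "n \<in> range nat_of_str" for n
  proof (induction n rule: less_induct)
    case (less n)
    show ?case
    proof (cases "n = 0")
      case True
      then show ?thesis by (metis nat_of_str_Nil rangeI)
    next
      case False
      then have "(n - 1) div 2 < n" by simp
      then obtain w where w: "(n - 1) div 2 = nat_of_str w" using less.IH by blast
      have "n = 2 * ((n - 1) div 2) + (if even n then 2 else 1)"
        using False by presburger
      then have "n = nat_of_str (w @ [even n])" unfolding nat_of_str_snoc w .
      then show ?thesis by blast
    qed
  qed
  then show "surj nat_of_str" by blast
qed


definition strings_of :: "nat set \<Rightarrow> bool list set" where
  "strings_of K = {w. nat_of_str w \<in> K}"


section \<open>Nondeterministic oracle Turing machines\<close>

text \<open>Multi-tape machines with two-way infinite tapes: tape 0 carries the input, tape 1 is the oracle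
  tape. A tape is its contents together with the head position. States are natural numbers and the
  tape alphabet is a type with infinitely many auxiliary symbols; every single machine uses only
  finitely many of both, as its transition table is finite.\<close>

datatype sym = Blank | Bit bool | Aux nat

datatype dir = MoveL | Stay | MoveR

type_synonym tape = "(int \<Rightarrow> sym) \<times> int"

type_synonym config = "nat \<times> tape list"

text \<open>An entry \<open>(q, rs, q', ws, ds)\<close> of the transition table: in state \<open>q\<close>, when the symbols \<open>rs\<close> are
  scanned on the tapes, the machine may write \<open>ws\<close>, move the heads by \<open>ds\<close> and enter state \<open>q'\<close>.\<close>

record otm =
  ntapes :: nat
  start_st :: nat
  query_st :: nat
  yes_st :: nat
  no_st :: nat
  accept_st :: nat
  trans :: "(nat \<times> sym list \<times> nat \<times> sym list \<times> dir list) set"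

definition wf_otm :: "otm \<Rightarrow> bool" where
  "wf_otm M \<longleftrightarrow>
     2 \<le> ntapes M \<and> accept_st M \<noteq> query_st M \<and> finite (trans M) \<and>
     (\<forall>(q, rs, q', ws, ds) \<in> trans M.
        length rs = ntapes M \<and> length ws = ntapes M \<and> length ds = ntapes M \<and>
        q \<noteq> query_st M \<and> q \<noteq> accept_st M)"

fun scanned :: "tape \<Rightarrow> sym" where
  "scanned (f, h) = f h"

fun dir_offset :: "dir \<Rightarrow> int" where
  "dir_offset MoveL = -1"
| "dir_offset Stay = 0"
| "dir_offset MoveR = 1"

fun update_tape :: "tape \<Rightarrow> sym \<times> dir \<Rightarrow> tape" where
  "update_tape (f, h) (s, d) = (f(h := s), h + dir_offset d)"

text \<open>The queried string is written in the cells 0, 1, \dots of the oracle tape and ends before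
  the first cell not holding a bit. On a tape with finitely many nonblank cells there is exactly one
  such string.\<close>

fun tape_holds :: "tape \<Rightarrow> bool list \<Rightarrow> bool" where
  "tape_holds (f, h) w \<longleftrightarrow>
     (\<forall>i < length w. f (int i) = Bit (w ! i)) \<and> f (int (length w)) \<notin> range Bit"

inductive step :: "otm \<Rightarrow> bool list set \<Rightarrow> config \<Rightarrow> config \<Rightarrow> bool" for M A where
  move: "(q, map scanned ts, q', ws, ds) \<in> trans M \<Longrightarrow>
           step M A (q, ts) (q', map2 update_tape ts (zip ws ds))"
| query_yes: "tape_holds (ts ! 1) w \<Longrightarrow> w \<in> A \<Longrightarrow> step M A (query_st M, ts) (yes_st M, ts)"
| query_no: "tape_holds (ts ! 1) w \<Longrightarrow> w \<notin> A \<Longrightarrow> step M A (query_st M, ts) (no_st M, ts)"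

definition tape_of :: "bool list \<Rightarrow> tape" where
  "tape_of w = (\<lambda>i. if 0 \<le> i \<and> i < int (length w) then Bit (w ! nat i) else Blank, 0)"

definition init_config :: "otm \<Rightarrow> bool list \<Rightarrow> config" where
  "init_config M w = (start_st M, tape_of w # replicate (ntapes M - 1) (tape_of []))"

definition accepts :: "otm \<Rightarrow> bool list set \<Rightarrow> bool list \<Rightarrow> bool" where
  "accepts M A w \<longleftrightarrow> (\<exists>ts. (step M A)\<^sup>*\<^sup>* (init_config M w) (accept_st M, ts))"

definition runs_in_time :: "otm \<Rightarrow> bool list set \<Rightarrow> nat poly \<Rightarrow> bool" where
  "runs_in_time M A p \<longleftrightarrow>
     (\<forall>w n c. ((step M A) ^^ n) (init_config M w) c \<longrightarrow> n \<le> poly p (length w))"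

definition NP_rel :: "bool list set \<Rightarrow> bool list set set" where
  "NP_rel A = {L. \<exists>M p. wf_otm M \<and> runs_in_time M A p \<and> L = {w. accepts M A w}}"

definition coNP_rel :: "bool list set \<Rightarrow> bool list set set" where
  "coNP_rel A = {L. - L \<in> NP_rel A}"

abbreviation NP_oracle :: "nat set \<Rightarrow> bool list set set" where
  "NP_oracle K \<equiv> NP_rel (strings_of K)"

abbreviation coNP_oracle :: "nat set \<Rightarrow> bool list set set" where
  "coNP_oracle K \<equiv> coNP_rel (strings_of K)"


section \<open>The Ellentuck topology\<close>

definition nowhere_dense_in :: "'a topology \<Rightarrow> 'a set \<Rightarrow> bool" where
  "nowhere_dense_in X S \<longleftrightarrow> S \<subseteq> topspace X \<and> X interior_of (X closure_of S) = {}"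

definition meager_in :: "'a topology \<Rightarrow> 'a set \<Rightarrow> bool" where
  "meager_in X S \<longleftrightarrow> (\<exists>N :: nat \<Rightarrow> 'a set. (\<forall>n. nowhere_dense_in X (N n)) \<and> S = (\<Union>n. N n))"

definition comeager_in :: "'a topology \<Rightarrow> 'a set \<Rightarrow> bool" where
  "comeager_in X S \<longleftrightarrow> S \<subseteq> topspace X \<and> meager_in X (topspace X - S)"

text \<open>\<open>max a + 1\<close>, read as 0 for \<open>a = {}\<close>.\<close>

definition max_succ :: "nat set \<Rightarrow> nat" where
  "max_succ a = (if a = {} then 0 else Suc (Max a))"

definition ellentuck_basic :: "nat set \<Rightarrow> nat set \<Rightarrow> nat set set" where
  "ellentuck_basic a A = {S. infinite S \<and> S \<inter> {..<max_succ a} = a \<and> S - a \<subseteq> A}"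

definition ellentuck :: "nat set topology" where
  "ellentuck = topology_generated_by
     {ellentuck_basic a A | a A. finite a \<and> infinite A \<and> (\<forall>x\<in>a. \<forall>y\<in>A. x < y)}"

lemma topspace_ellentuck: "topspace ellentuck = {S. infinite S}"
proof -
  let ?B = "{ellentuck_basic a A | a A. finite a \<and> infinite A \<and> (\<forall>x\<in>a. \<forall>y\<in>A. x < y)}"
  have "{S. infinite S} = ellentuck_basic {} UNIV"
    by (auto simp: ellentuck_basic_def max_succ_def)
  then have "{S. infinite S} \<in> ?B"
    by (intro CollectI exI[of _ "{}"] exI[of _ "UNIV :: nat set"]) simp
  moreover have "\<Union>?B \<subseteq> {S. infinite S}"
  proof (rule Union_least)
    fix U assume "U \<in> ?B"
    then obtain a A where "U = ellentuck_basic a A" by auto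
    then show "U \<subseteq> {S. infinite S}" by (auto simp: ellentuck_basic_def)
  qed
  ultimately have "\<Union>?B = {S. infinite S}" by (intro equalityI Union_upper)
  then show ?thesis
    by (simp only: ellentuck_def topology_generated_by_topspace)
qed

definition ramsey_small :: "nat set set \<Rightarrow> bool" where
  "ramsey_small S \<longleftrightarrow> meager_in ellentuck S"

definition ramsey_large :: "nat set set \<Rightarrow> bool" where
  "ramsey_large S \<longleftrightarrow> comeager_in ellentuck S"

definition ramsey_positive :: "nat set set \<Rightarrow> bool" where
  "ramsey_positive S \<longleftrightarrow> S \<subseteq> topspace ellentuck \<and> \<not> ramsey_small S"


section \<open>The set of separating oracles\<close>

definition O' :: "nat set set" where
  "O' = {K. infinite K \<and> NP_oracle K \<noteq> coNP_oracle K}"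

end

theory Submission
  imports Defs "HOL-Real_Asymp.Real_Asymp"
begin

text \<open>
  The language of all words having the length of some string in the oracle is in \<open>NP\<close> by guessing
  the string. An infinite set of strings \<open>x 0, x 1, \<dots>\<close> of rapidly increasing length is built such
  that the complement of this language is not in \<open>NP\<close> relative to any infinite subset. At stage
  \<open>j\<close> only finitely many oracles \<open>a \<subseteq> {x i | i < j}\<close> and finitely many clocked machines matter. If
  a machine with oracle \<open>a\<close> rejects some \<open>0\<^sup>m\<close> that is longer than all previous strings, then
  \<open>x j\<close> is made so long that the computation on \<open>0\<^sup>m\<close> cannot query it. Otherwise the machine accepts
  \<open>0\<^sup>n\<close> for all large \<open>n\<close>; as an accepting path makes only polynomially many queries, \<open>x j\<close> of
  length \<open>n\<close> can be chosen outside all of them, and adding \<open>x j\<close> to the oracle does not destroy the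
  acceptance, which is now wrong. Ramsey positivity follows since the infinite subsets of
  an infinite set form a nonempty open set in the Ellentuck topology, which is Baire by fusion.
\<close>

section \<open>Countably many machines\<close>

instance sym :: countable by countable_datatype

instance dir :: countable by countable_datatype

text \<open>Apart from the transition table all fields are numbers, and \<open>wf_otm\<close> makes
  the table a finite subset of a countable type.\<close>

lemma countable_wf_otm: "countable {M. wf_otm M}"
proof -
  let ?f = "\<lambda>M. ((ntapes M, start_st M, query_st M, yes_st M, no_st M, accept_st M), trans M)"
  have "inj_on ?f {M. wf_otm M}"
    by (rule inj_onI) (auto intro: otm.equality)
  moreover have "?f ` {M. wf_otm M} \<subseteq> UNIV \<times> {T. finite T}"
    by (auto simp: wf_otm_def)
  moreover have "countable (UNIV \<times> {T. finite T}
      :: ((nat \<times> nat \<times> nat \<times> nat \<times> nat \<times> nat) \<times> (nat \<times> sym list \<times> nat \<times> sym list \<times> dir list) set) set)"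
    by (intro countable_SIGMA countableI_type countable_Collect_finite)
  ultimately show ?thesis
    using countable_image_inj_on countable_subset by blast
qed

lemma countable_UNIV_nat_poly: "countable (UNIV :: nat poly set)"
proof -
  have "inj (coeffs :: nat poly \<Rightarrow> nat list)"
    by (rule injI) (simp add: coeffs_eq_iff)
  then show ?thesis
    using countable_image_inj_on countableI_type by blast
qed

text \<open>Serves the counting argument: polynomially many queried strings cannot exhaust the
  \<open>2 ^ n\<close> strings of length \<open>n\<close>.\<close>

lemma poly_less_power2: "\<forall>\<^sub>F n in sequentially. poly (q :: nat poly) n < 2 ^ n"
proof -
  have "(\<lambda>n. real n ^ i / 2 ^ n) \<longlonglongrightarrow> 0" for i
    by real_asymp
  then have "(\<lambda>n. \<Sum>i\<le>degree q. real (coeff q i) * (real n ^ i / 2 ^ n)) \<longlonglongrightarrow> 0"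
    by (intro tendsto_null_sum tendsto_mult_right_zero)
  then have "\<forall>\<^sub>F n in sequentially. (\<Sum>i\<le>degree q. real (coeff q i) * (real n ^ i / 2 ^ n)) < 1"
    by (rule order_tendstoD) simp
  then show ?thesis
  proof eventually_elim
    case (elim n)
    have "real (poly q n) / 2 ^ n = (\<Sum>i\<le>degree q. real (coeff q i) * (real n ^ i / 2 ^ n))"
      by (simp add: poly_altdef sum_divide_distrib)
    with elim have "real (poly q n) / 2 ^ n < 1" by (simp only:)
    then have "real (poly q n) < 2 ^ n" by simp
    then show ?case by (metis of_nat_less_iff of_nat_numeral of_nat_power)
  qed
qed


section \<open>Runs depend on few short queries\<close>

text \<open>The head of the oracle tape gains at most one cell per step, so after \<open>n\<close>
  steps the cells from \<open>n\<close> on are still blank and a query made then has length at most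
  \<open>n\<close>. Each step adds at most one string to \<open>Q\<close>.\<close>

lemma run_use:
  assumes "wf_otm M" and "(step M A ^^ n) (init_config M w) c"
  shows "length (snd c) = ntapes M \<and> snd (snd c ! 1) \<le> int n \<and> (\<forall>i\<ge>int n. fst (snd c ! 1) i = Blank) \<and>
    (\<exists>Q. finite Q \<and> card Q \<le> n \<and> (\<forall>q\<in>Q. length q \<le> n) \<and>
      (\<forall>B. (\<forall>q\<in>Q. q \<in> B \<longleftrightarrow> q \<in> A) \<longrightarrow> (step M B ^^ n) (init_config M w) c))"
  using assms(2)
proof (induction n arbitrary: c)
  case 0
  then have c: "c = init_config M w" by simp
  have "2 \<le> ntapes M" using assms(1) by (simp add: wf_otm_def)
  then show ?case
    by (auto simp: c init_config_def tape_of_def intro!: exI[of _ "{}"])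
next
  case (Suc n)
  from Suc.prems obtain d where d: "(step M A ^^ n) (init_config M w) d" "step M A d c"
    by auto
  from Suc.IH[OF d(1)] obtain Q where len: "length (snd d) = ntapes M"
    and head: "snd (snd d ! 1) \<le> int n" and blank: "\<And>i. i \<ge> int n \<Longrightarrow> fst (snd d ! 1) i = Blank"
    and Q: "finite Q" "card Q \<le> n" "\<forall>q\<in>Q. length q \<le> n"
    and agree: "\<And>B. (\<forall>q\<in>Q. q \<in> B \<longleftrightarrow> q \<in> A) \<Longrightarrow> (step M B ^^ n) (init_config M w) d"
    by blast
  \<comment> \<open>Both query rules keep the tapes and consult the oracle only at \<open>v\<close>,
    so one argument covers both answers.\<close>
  have query: ?case
    if h: "tape_holds (snd d ! 1) v" and c: "snd c = snd d"
      and stp: "\<And>B. v \<in> B \<longleftrightarrow> v \<in> A \<Longrightarrow> step M B d c" for v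
  proof -
    obtain f k where fk: "snd d ! 1 = (f, k)" by fastforce
    have "length v \<le> n"
    proof (rule ccontr)
      assume "\<not> length v \<le> n"
      then have "f (int n) = Bit (v ! n)" using h fk by simp
      then show False using blank[of "int n"] fk by simp
    qed
    then show ?thesis
      using len head blank c Q agree stp
      by (intro conjI exI[of _ "insert v Q"])
        (auto simp: card_insert_if le_SucI intro!: relcomppI)
  qed
  show ?case
    using d(2)
  proof cases
    case (move q ts q' ws ds)
    have l: "length ts = ntapes M" "length ws = ntapes M" "length ds = ntapes M" "2 \<le> ntapes M"
      using assms(1) move(3) len move(1) by (auto simp: wf_otm_def)
    obtain f k where fk: "ts ! 1 = (f, k)" by fastforce
    have nth: "snd c ! 1 = (f(k := ws ! 1), k + dir_offset (ds ! 1))"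
      using l fk by (simp add: move(2))
    have off: "dir_offset (ds ! 1) \<le> 1" by (cases "ds ! 1") auto
    have "k \<le> int n" "\<And>i. i \<ge> int n \<Longrightarrow> f i = Blank"
      using head blank fk move(1) by auto
    moreover have "step M B d c" for B
      unfolding move(1,2) by (rule step.move) (rule move(3))
    ultimately show ?thesis
      using Q agree off nth l by (intro conjI exI[of _ Q]) (auto simp: move(2) intro!: relcomppI)
  next
    case (query_yes ts v)
    show ?thesis
      by (rule query[of v]) (use query_yes in \<open>auto intro: step.query_yes\<close>)
  next
    case (query_no ts v)
    show ?thesis
      by (rule query[of v]) (use query_no in \<open>auto intro: step.query_no\<close>)
  qed
qed

text \<open>The explicit clock is there because a machine that obeys its time bound for one oracle
  may violate it for the finite oracles used during the construction.\<close>

definition accepts_within :: "otm \<Rightarrow> bool list set \<Rightarrow> bool list \<Rightarrow> nat \<Rightarrow> bool" where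
  "accepts_within M A w t \<longleftrightarrow> (\<exists>n\<le>t. \<exists>ts. (step M A ^^ n) (init_config M w) (accept_st M, ts))"

lemma accepts_within_imp_accepts: "accepts_within M A w t \<Longrightarrow> accepts M A w"
  unfolding accepts_within_def accepts_def by (metis relpowp_imp_rtranclp)

lemma accepts_imp_accepts_within:
  assumes "runs_in_time M A p" and "accepts M A w"
  shows "accepts_within M A w (poly p (length w))"
  using assms unfolding accepts_within_def accepts_def runs_in_time_def
  by (metis rtranclp_imp_relpowp)

lemma accepts_within_use:
  assumes "wf_otm M" and "accepts_within M A w t"
  obtains Q where "finite Q" "card Q \<le> t" "\<And>q. q \<in> Q \<Longrightarrow> length q \<le> t"
    "\<And>B. (\<And>q. q \<in> Q \<Longrightarrow> q \<in> B \<longleftrightarrow> q \<in> A) \<Longrightarrow> accepts_within M B w t"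
proof -
  from assms(2) obtain n ts where n: "n \<le> t" "(step M A ^^ n) (init_config M w) (accept_st M, ts)"
    unfolding accepts_within_def by blast
  from run_use[OF assms(1) n(2)] obtain Q where Q: "finite Q" "card Q \<le> n" "\<forall>q\<in>Q. length q \<le> n"
    "\<forall>B. (\<forall>q\<in>Q. q \<in> B \<longleftrightarrow> q \<in> A) \<longrightarrow> (step M B ^^ n) (init_config M w) (accept_st M, ts)"
    by blast
  have "accepts_within M B w t" if "\<And>q. q \<in> Q \<Longrightarrow> q \<in> B \<longleftrightarrow> q \<in> A" for B
    unfolding accepts_within_def using Q(4) that n(1) by blast
  then show thesis using that[of Q] Q n(1) by fastforce
qed

lemma accepts_within_cong_short:
  assumes "wf_otm M" and "\<And>q. length q \<le> t \<Longrightarrow> q \<in> B \<longleftrightarrow> q \<in> A" and "accepts_within M A w t"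
  shows "accepts_within M B w t"
  using assms accepts_within_use by metis


section \<open>The language of lengths of oracle strings\<close>

definition length_lang :: "bool list set \<Rightarrow> bool list set" where
  "length_lang A = {w. \<exists>v\<in>A. length v = length w}"

text \<open>One bit is guessed per input cell, so the query has the length of the input. A positive
  answer accepts at once, a negative one leads to a dead end.\<close>

definition guess_otm :: otm where
  "guess_otm = \<lparr>ntapes = 2, start_st = 0, query_st = 1, yes_st = 2, no_st = 3, accept_st = 2,
     trans = insert (0, [Blank, Blank], 1, [Blank, Blank], [Stay, Stay])
       ((\<lambda>(b, c). (0, [Bit b, Blank], 0, [Bit b, Bit c], [MoveR, MoveR])) ` UNIV)\<rparr>"

section \<open>Correctness and running time of the guessing machine\<close>

lemma guess_otm_simps [simp]:
  "ntapes guess_otm = 2" "start_st guess_otm = 0" "query_st guess_otm = 1" "yes_st guess_otm = 2"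
  "no_st guess_otm = 3" "accept_st guess_otm = 2"
  by (simp_all add: guess_otm_def)

lemma trans_guess_otm:
  "(q, rs, q', ws, ds) \<in> trans guess_otm \<longleftrightarrow>
     q = 0 \<and> rs = [Blank, Blank] \<and> q' = 1 \<and> ws = [Blank, Blank] \<and> ds = [Stay, Stay] \<or>
     (\<exists>b c. q = 0 \<and> rs = [Bit b, Blank] \<and> q' = 0 \<and> ws = [Bit b, Bit c] \<and> ds = [MoveR, MoveR])"
  by (auto simp: guess_otm_def)

lemma wf_guess_otm: "wf_otm guess_otm"
  unfolding wf_otm_def by (auto simp: trans_guess_otm) (simp add: guess_otm_def)

abbreviation cells :: "bool list \<Rightarrow> int \<Rightarrow> sym" where
  "cells u \<equiv> fst (tape_of u)"

lemma cells_snoc: "(cells u)(int (length u) := Bit b) = cells (u @ [b])"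
  by (rule ext) (auto simp: tape_of_def nth_append)

lemma cells_length: "cells u (int (length u)) = Blank"
  by (simp add: tape_of_def)

lemma cells_nth: "i < length u \<Longrightarrow> cells u (int i) = Bit (u ! i)"
  by (simp add: tape_of_def)

lemma tape_holds_cells: "tape_holds (cells u, h) v \<longleftrightarrow> v = u"
proof
  assume h: "tape_holds (cells u, h) v"
  have "length v \<le> length u"
    using h cells_length[of u] by (metis not_le sym.distinct(1) tape_holds.simps)
  moreover have "\<not> length v < length u"
    using h cells_nth[of "length v" u] by auto
  ultimately show "v = u"
    using h by (auto simp: cells_nth intro!: nth_equalityI)
qed (auto simp: cells_nth cells_length)

text \<open>\<open>k\<close> counts the steps; the disjuncts are the guessing, query and answer
  phases. As each of them forces \<open>k \<le> length w + 2\<close>, the invariant yields the time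
  bound as well as soundness.\<close>

definition guess_inv :: "bool list set \<Rightarrow> bool list \<Rightarrow> nat \<Rightarrow> config \<Rightarrow> bool" where
  "guess_inv A w k c \<longleftrightarrow>
     k \<le> length w \<and> (\<exists>u. length u = k \<and> c = (0, [(cells w, int k), (cells u, int k)])) \<or>
     k = length w + 1 \<and> (\<exists>u h h'. length u = length w \<and> c = (1, [(cells w, h), (cells u, h')])) \<or>
     k = length w + 2 \<and> (fst c = 2 \<and> w \<in> length_lang A \<or> fst c = 3)"

lemma guess_inv_step:
  assumes "guess_inv A w k c" and "step guess_otm A c d"
  shows "guess_inv A w (Suc k) d"
  using assms(2)
proof cases
  case (move q ts q' ws ds)
  then have "q = 0" by (auto simp: trans_guess_otm)
  with assms(1) move(1) obtain u where k: "k \<le> length w" and u: "length u = k"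
    and ts: "ts = [(cells w, int k), (cells u, int k)]"
    by (auto simp: guess_inv_def)
  show ?thesis
  proof (cases "k = length w")
    case True
    then show ?thesis
      using move u unfolding guess_inv_def
      by (auto simp: trans_guess_otm ts cells_length intro!: exI[of _ u])
  next
    case False
    with k have "k < length w" by simp
    then obtain b where "q' = 0" "ws = [Bit (w ! k), Bit b]" "ds = [MoveR, MoveR]"
      using move(3) by (auto simp: trans_guess_otm ts cells_nth)
    then have "d = (0, [(cells w, int (Suc k)), (cells (u @ [b]), int (Suc k))])"
      using u \<open>k < length w\<close> cells_snoc[of u b] cells_nth[of k w]
      by (simp add: move(2) ts fun_upd_idem)
    then show ?thesis
      using u \<open>k < length w\<close> unfolding guess_inv_def by (auto intro!: exI[of _ "u @ [b]"])
  qed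
next
  case (query_yes ts v)
  then show ?thesis
    using assms(1) by (auto simp: guess_inv_def length_lang_def tape_holds_cells simp del: tape_holds.simps)
next
  case (query_no ts v)
  then show ?thesis
    using assms(1) by (auto simp: guess_inv_def)
qed

lemma guess_inv_run:
  "(step guess_otm A ^^ k) (init_config guess_otm w) c \<Longrightarrow> guess_inv A w k c"
proof (induction k arbitrary: c)
  case 0
  then show ?case
    by (auto simp: guess_inv_def init_config_def tape_of_def)
next
  case (Suc k)
  from Suc.prems obtain d where "(step guess_otm A ^^ k) (init_config guess_otm w) d" "step guess_otm A d c"
    by auto
  then show ?case using Suc.IH guess_inv_step by blast
qed

text \<open>The completeness half: every guessed bit is a free choice, and induction from the right
  end follows the run.\<close>

lemma guess_run:
  assumes "length u \<le> length w"
  shows "(step guess_otm A)\<^sup>*\<^sup>* (init_config guess_otm w)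
    (0, [(cells w, int (length u)), (cells u, int (length u))])"
  using assms
proof (induction u rule: rev_induct)
  case Nil
  then show ?case by (simp add: init_config_def tape_of_def)
next
  case (snoc b u)
  let ?ts = "[(cells w, int (length u)), (cells u, int (length u))]"
  let ?ws = "[Bit (w ! length u), Bit b]" and ?ds = "[MoveR, MoveR]"
  have "step guess_otm A (0, ?ts) (0, map2 update_tape ?ts (zip ?ws ?ds))"
    using snoc.prems by (intro step.move) (auto simp: trans_guess_otm cells_length cells_nth)
  also have "map2 update_tape ?ts (zip ?ws ?ds) =
      [(cells w, int (length (u @ [b]))), (cells (u @ [b]), int (length (u @ [b])))]"
    using snoc.prems by (simp add: cells_snoc cells_nth fun_upd_idem)
  finally show ?case
    using snoc by (auto intro: rtranclp.rtrancl_into_rtrancl)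
qed

lemma accepts_guess_otm: "accepts guess_otm A w \<longleftrightarrow> w \<in> length_lang A"
proof
  assume "accepts guess_otm A w"
  then obtain k ts where "(step guess_otm A ^^ k) (init_config guess_otm w) (2, ts)"
    unfolding accepts_def by (metis guess_otm_simps(6) rtranclp_imp_relpowp)
  then show "w \<in> length_lang A"
    using guess_inv_run unfolding guess_inv_def by fastforce
next
  assume "w \<in> length_lang A"
  then obtain v where v: "v \<in> A" "length v = length w"
    unfolding length_lang_def by blast
  let ?ts = "[(cells w, int (length v)), (cells v, int (length v))]"
  have "(step guess_otm A)\<^sup>*\<^sup>* (init_config guess_otm w) (0, ?ts)"
    using v by (intro guess_run) simp
  \<comment> \<open>Since \<open>v\<close> and \<open>w\<close> have equal length, both heads have
    reached the first blank cell together.\<close>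
  also have "step guess_otm A (0, ?ts)
      (1, map2 update_tape ?ts (zip [Blank, Blank] [Stay, Stay]))"
    using v cells_length[of v] cells_length[of w] by (intro step.move) (auto simp: trans_guess_otm)
  also have "map2 update_tape ?ts (zip [Blank, Blank] [Stay, Stay]) = ?ts"
    using v cells_length[of v] cells_length[of w] by (simp add: fun_upd_idem)
  also have "step guess_otm A (1, ?ts) (2, ?ts)"
    using step.query_yes[of ?ts v A guess_otm] v by (simp add: tape_holds_cells del: tape_holds.simps)
  finally show "accepts guess_otm A w"
    unfolding accepts_def by auto
qed

lemma length_lang_in_NP_rel: "length_lang A \<in> NP_rel A"
proof -
  have "n \<le> poly [:2, 1:] (length w)"
    if "(step guess_otm A ^^ n) (init_config guess_otm w) c" for w n c
    using guess_inv_run[OF that] by (auto simp: guess_inv_def)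
  then have "runs_in_time guess_otm A [:2, 1:]"
    unfolding runs_in_time_def by blast
  then show ?thesis
    unfolding NP_rel_def using wf_guess_otm accepts_guess_otm by blast
qed


section \<open>Diagonalization\<close>

abbreviation unary :: "nat \<Rightarrow> bool list" where
  "unary n \<equiv> replicate n False"

text \<open>\<open>a\<close> is the part of a subset of \<open>H\<close> below \<open>x\<close>. In the first alternative of the
  disjunction the machine wrongly rejects \<open>unary m\<close>, in the second it wrongly accepts
  \<open>unary (length x)\<close> as soon as \<open>x\<close> is put into the oracle.\<close>

definition diagonalizes :: "bool list set \<Rightarrow> (otm \<times> nat poly) set \<Rightarrow> bool list \<Rightarrow> bool" where
  "diagonalizes F P x \<longleftrightarrow>
     (\<forall>y\<in>F. length y < length x) \<and>
     (\<forall>(M, p)\<in>P. (\<forall>y\<in>F. poly p (length y) < length x) \<and>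
       (\<forall>a\<subseteq>F.
         (\<exists>m. (\<forall>y\<in>F. length y < m) \<and> m < length x \<and> poly p m < length x \<and>
            \<not> accepts_within M a (unary m) (poly p m)) \<or>
         (\<forall>B. (\<forall>q. length q \<le> poly p (length x) \<longrightarrow> q \<noteq> x \<longrightarrow> (q \<in> B \<longleftrightarrow> q \<in> a)) \<longrightarrow>
            accepts_within M B (unary (length x)) (poly p (length x)))))"

lemma diagonalizes_poly_less:
  assumes "diagonalizes F P x" and "(M, p) \<in> P" and "y \<in> F"
  shows "poly p (length y) < length x"
proof -
  have "\<forall>y\<in>F. poly p (length y) < length x"
    using bspec[OF conjunct2[OF assms(1)[unfolded diagonalizes_def]] assms(2)] by simp
  with assms(3) show ?thesis by blast
qed

lemma diagonalizes_cases [consumes 3]: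
  assumes "diagonalizes F P x" and "(M, p) \<in> P" and "a \<subseteq> F"
  obtains (reject) m where "\<forall>y\<in>F. length y < m" "m < length x" "poly p m < length x"
      "\<not> accepts_within M a (unary m) (poly p m)"
  | (accept) "\<And>B. (\<And>q. length q \<le> poly p (length x) \<Longrightarrow> q \<noteq> x \<Longrightarrow> q \<in> B \<longleftrightarrow> q \<in> a) \<Longrightarrow>
      accepts_within M B (unary (length x)) (poly p (length x))"
proof -
  have "(\<exists>m. (\<forall>y\<in>F. length y < m) \<and> m < length x \<and> poly p m < length x \<and>
        \<not> accepts_within M a (unary m) (poly p m)) \<or>
      (\<forall>B. (\<forall>q. length q \<le> poly p (length x) \<longrightarrow> q \<noteq> x \<longrightarrow> (q \<in> B \<longleftrightarrow> q \<in> a)) \<longrightarrow>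
        accepts_within M B (unary (length x)) (poly p (length x)))"
    using bspec[OF conjunct2[OF assms(1)[unfolded diagonalizes_def]] assms(2)] assms(3) by simp
  with that show thesis by blast
qed

text \<open>Finitely many triples of machine, clock and oracle matter, so one length
  \<open>n\<close> can exceed all their thresholds and also make their joint number of queries
  smaller than \<open>2 ^ n\<close>.\<close>

lemma ex_diagonalizes:
  assumes F: "finite F" and P: "finite P" and wf: "\<And>M p. (M, p) \<in> P \<Longrightarrow> wf_otm M"
  shows "\<exists>x. diagonalizes F P x"
proof -
  define l where "l = Suc (Max (insert 0 (length ` F)))"
  have l: "length y < l" if "y \<in> F" for y
    using that F unfolding l_def by (simp add: le_imp_less_Suc)
  \<comment> \<open>\<open>R c m\<close> says that \<open>m\<close> is a rejection witness for the
    triple \<open>c\<close>.\<close>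
  define R where "R = (\<lambda>(M, p, a) m. l \<le> m \<and> \<not> accepts_within M a (unary m) (poly p m))"
  define C where "C = (\<lambda>((M, p), a). (M, p, a)) ` (P \<times> Pow F)"
  have C: "finite C" unfolding C_def using F P by blast
  \<comment> \<open>This single polynomial bounds the queries of all triples together.\<close>
  define q where "q = (\<Sum>(M, p, a)\<in>C. p)"
  \<comment> \<open>If \<open>c\<close> has no rejection witness, this is an arbitrary number, and
    requiring \<open>n\<close> to exceed the resulting bounds does no harm.\<close>
  define wit where "wit = (\<lambda>c. SOME m. R c m)"
  have ev1: "\<forall>\<^sub>F n in sequentially. \<forall>(M, p)\<in>P. \<forall>y\<in>F. poly p (length y) < n"
    by (auto intro!: eventually_ball_finite[OF P] eventually_ball_finite[OF F] eventually_gt_at_top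
        simp: case_prod_unfold)
  have ev2: "\<forall>\<^sub>F n in sequentially. \<forall>(M, p, a)\<in>C. wit (M, p, a) < n \<and> poly p (wit (M, p, a)) < n"
    by (auto intro!: eventually_ball_finite[OF C] eventually_conj eventually_gt_at_top
        simp: case_prod_unfold)
  obtain n where n: "l \<le> n" "poly q n < 2 ^ n" "\<And>M p y. (M, p) \<in> P \<Longrightarrow> y \<in> F \<Longrightarrow> poly p (length y) < n"
    "\<And>M p a. (M, p, a) \<in> C \<Longrightarrow> wit (M, p, a) < n \<and> poly p (wit (M, p, a)) < n"
    using eventually_happens'[OF _ eventually_conj[OF eventually_ge_at_top[of l]
        eventually_conj[OF poly_less_power2[of q] eventually_conj[OF ev1 ev2]]]]
    by fastforce
  define use where "use = (\<lambda>(M, p, a) Q. finite Q \<and> card Q \<le> poly p n \<and>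
    (\<forall>B. (\<forall>q\<in>Q. q \<in> B \<longleftrightarrow> q \<in> a) \<longrightarrow> accepts_within M B (unary n) (poly p n)) \<and>
    (\<forall>q\<in>Q. length q \<le> poly p n))"
  \<comment> \<open>A triple with a rejection witness restricts only the length of \<open>x\<close>,
    so it forbids no strings and \<open>{}\<close> serves.\<close>
  have "\<exists>Q. finite Q \<and> card Q \<le> poly (fst (snd c)) n \<and> ((\<exists>m. R c m) \<or> use c Q)" if "c \<in> C" for c
  proof (cases "\<exists>m. R c m")
    case True
    then show ?thesis by (intro exI[of _ "{}"]) auto
  next
    case False
    obtain M p a where c: "c = (M, p, a)" by (cases c)
    have "wf_otm M" using that wf by (auto simp: c C_def)
    moreover have "accepts_within M a (unary n) (poly p n)"
      using False n(1) by (auto simp: c R_def)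
    ultimately show ?thesis
    proof (rule accepts_within_use)
      fix Q
      assume Q: "finite Q" "card Q \<le> poly p n" "\<And>q. q \<in> Q \<Longrightarrow> length q \<le> poly p n"
        "\<And>B. (\<And>q. q \<in> Q \<Longrightarrow> q \<in> B \<longleftrightarrow> q \<in> a) \<Longrightarrow> accepts_within M B (unary n) (poly p n)"
      then have "use c Q" unfolding use_def c by blast
      then show ?thesis using Q(1,2) by (auto simp: c)
    qed
  qed
  then obtain Q where Q: "\<And>c. c \<in> C \<Longrightarrow> finite (Q c)"
      "\<And>c. c \<in> C \<Longrightarrow> card (Q c) \<le> poly (fst (snd c)) n"
      "\<And>c. c \<in> C \<Longrightarrow> (\<exists>m. R c m) \<or> use c (Q c)"
    by metis
  have "card (\<Union>c\<in>C. Q c) \<le> (\<Sum>c\<in>C. card (Q c))"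
    by (rule card_UN_le[OF C])
  also have "\<dots> \<le> (\<Sum>c\<in>C. poly (fst (snd c)) n)"
    by (intro sum_mono Q(2))
  also have "\<dots> = poly q n"
    by (simp add: q_def poly_sum case_prod_unfold)
  also have "\<dots> < 2 ^ n" by (rule n(2))
  also have "\<dots> = card {v :: bool list. set v \<subseteq> UNIV \<and> length v = n}"
    by (subst card_lists_length_eq) auto
  finally have "\<not> {v :: bool list. set v \<subseteq> UNIV \<and> length v = n} \<subseteq> (\<Union>c\<in>C. Q c)"
    using C Q(1) by (meson card_mono finite_UN_I not_le)
  then obtain x where x: "length x = n" "\<And>c. c \<in> C \<Longrightarrow> x \<notin> Q c" by auto
  have "diagonalizes F P x"
    unfolding diagonalizes_def
  proof (intro conjI ballI, goal_cases)
    case (1 y)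
    then show ?case using l n(1) x(1) by fastforce
  next
    case (2 c)
    obtain M p where c: "c = (M, p)" by (cases c)
    have *: "(\<exists>m. (\<forall>y\<in>F. length y < m) \<and> m < length x \<and> poly p m < length x \<and>
          \<not> accepts_within M a (unary m) (poly p m)) \<or>
        (\<forall>B. (\<forall>q. length q \<le> poly p (length x) \<longrightarrow> q \<noteq> x \<longrightarrow> (q \<in> B \<longleftrightarrow> q \<in> a)) \<longrightarrow>
          accepts_within M B (unary (length x)) (poly p (length x)))" if "a \<subseteq> F" for a
    proof -
      have d: "(M, p, a) \<in> C" 
        using 2 that unfolding C_def c by (intro image_eqI[of _ _ "((M, p), a)"]) auto
      show ?thesis
      proof (cases "\<exists>m. R (M, p, a) m")
        case True
        then have "R (M, p, a) (wit (M, p, a))" unfolding wit_def by (rule someI_ex)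
        then have "l \<le> wit (M, p, a)"
          and "\<not> accepts_within M a (unary (wit (M, p, a))) (poly p (wit (M, p, a)))"
          by (simp_all add: R_def)
        moreover have "\<forall>y\<in>F. length y < wit (M, p, a)"
          using l \<open>l \<le> wit (M, p, a)\<close> by (metis less_le_trans)
        ultimately show ?thesis
          using n(4)[OF d] x(1) by blast
      next
        case False
        then have "use (M, p, a) (Q (M, p, a))" using Q(3)[OF d] by blast
        then have short: "\<forall>q\<in>Q (M, p, a). length q \<le> poly p n"
          and acc: "\<And>B. \<forall>q\<in>Q (M, p, a). q \<in> B \<longleftrightarrow> q \<in> a \<Longrightarrow> accepts_within M B (unary n) (poly p n)"
          by (simp_all add: use_def)
        \<comment> \<open>The strings in \<open>Q (M, p, a)\<close> are short and differ from
          \<open>x\<close>, so \<open>B\<close> agrees with \<open>a\<close> on all of them.\<close>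
        have "accepts_within M B (unary n) (poly p n)"
          if B: "\<forall>q. length q \<le> poly p n \<longrightarrow> q \<noteq> x \<longrightarrow> (q \<in> B \<longleftrightarrow> q \<in> a)" for B
          by (rule acc) (use short B x(2)[OF d] in blast)
        then show ?thesis unfolding x(1) by blast
      qed
    qed
    show ?case using * 2 n(3) x(1) by (auto simp: c)
  qed
  then show ?thesis ..
qed

text \<open>Stage \<open>j\<close> depends on all earlier strings, hence choice along the
  well-order. It treats every pair up to index \<open>j\<close>, because a subset of the range may
  omit any particular \<open>x j\<close>.\<close>

lemma ex_diagonal_sequence:
  fixes e :: "nat \<Rightarrow> otm \<times> nat poly"
  assumes "\<And>i. wf_otm (fst (e i))"
  shows "\<exists>x. \<forall>j. diagonalizes (x ` {..<j}) (e ` {..j}) (x j)"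
proof (rule dependent_wellorder_choice)
  fix r :: "bool list" and f g :: "nat \<Rightarrow> bool list" and j :: nat
  assume "\<And>i. i < j \<Longrightarrow> f i = g i"
  then have "f ` {..<j} = g ` {..<j}" by auto
  then show "diagonalizes (f ` {..<j}) (e ` {..j}) r = diagonalizes (g ` {..<j}) (e ` {..j}) r"
    by simp
next
  fix j :: nat and f :: "nat \<Rightarrow> bool list"
  show "\<exists>r. diagonalizes (f ` {..<j}) (e ` {..j}) r"
    by (rule ex_diagonalizes) (use assms in \<open>auto, metis fst_conv\<close>)
qed

text \<open>An infinite \<open>A\<close> contains some \<open>x j\<close> with \<open>j\<close> at
  or beyond the index of a supposed pair \<open>(M, p)\<close>. Stage \<open>j\<close> defeats this
  pair for the finite part of \<open>A\<close> chosen earlier, and later strings are too long for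
  the clocked run to notice.\<close>

lemma compl_length_lang_notin_NP_rel:
  fixes e :: "nat \<Rightarrow> otm \<times> nat poly"
  assumes e: "\<And>M p. wf_otm M \<Longrightarrow> (M, p) \<in> range e"
    and x: "\<And>j. diagonalizes (x ` {..<j}) (e ` {..j}) (x j)"
    and A: "infinite A" "A \<subseteq> range x"
  shows "- length_lang A \<notin> NP_rel A"
proof
  assume "- length_lang A \<in> NP_rel A"
  then obtain M p where M: "wf_otm M" "runs_in_time M A p" "- length_lang A = {w. accepts M A w}"
    unfolding NP_rel_def by auto
  obtain k where k: "e k = (M, p)" using e[OF M(1)] by (metis imageE)
  have "\<exists>j\<ge>k. x j \<in> A"
  proof (rule ccontr)
    assume none: "\<not> ?thesis"
    have small: "x j \<notin> A" if "k \<le> j" for j using none that by blast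
    have "A \<subseteq> x ` {..<k}"
    proof
      fix y
      assume y: "y \<in> A"
      then obtain i where i: "y = x i" using A(2) by blast
      then have "\<not> k \<le> i" using y small by blast
      then show "y \<in> x ` {..<k}" by (simp add: i)
    qed
    then show False using A(1) by (meson finite_imageI finite_lessThan finite_subset)
  qed
  then obtain j where j: "k \<le> j" "x j \<in> A" by blast
  have mono: "length (x i) < length (x i')" if "i < i'" for i i'
    using x[of i'] that by (auto simp: diagonalizes_def)
  have polymono: "poly p (length (x i)) < length (x i')" if "i < i'" "k \<le> i'" for i i'
  proof -
    have "(M, p) \<in> e ` {..i'}" using that k by (metis atMost_iff imageI)
    then show ?thesis using diagonalizes_poly_less[OF x[of i']] that(1) by simp
  qed
  define a where "a = A \<inter> x ` {..<j}"
  \<comment> \<open>For the oracle \<open>A\<close> itself the time bound holds, so the clock cuts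
    off no acceptance.\<close>
  have acc: "accepts_within M A w (poly p (length w)) \<longleftrightarrow> w \<notin> length_lang A" for w
    using accepts_within_imp_accepts accepts_imp_accepts_within[OF M(2)] M(3) by blast
  note x[of j]
  moreover have "(M, p) \<in> e ` {..j}" using k j(1) by (metis atMost_iff imageI)
  moreover have "a \<subseteq> x ` {..<j}" by (simp add: a_def)
  ultimately show False
  proof (cases rule: diagonalizes_cases)
    case (reject m)
    have long: "length (x j) \<le> length (x i)" if "j \<le> i" for i
      using mono that by (metis le_eq_less_or_eq)
    \<comment> \<open>\<open>m\<close> lies strictly between the lengths before stage
      \<open>j\<close> and those from stage \<open>j\<close> on.\<close>
    have "unary m \<notin> length_lang A"
    proof
      assume "unary m \<in> length_lang A"
      then obtain i where "length (x i) = m" using A(2) by (auto simp: length_lang_def)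
      then show False using reject(1,2) long[of i] by (cases "i < j") auto
    qed
    then have "accepts_within M A (unary m) (poly p m)" using acc[of "unary m"] by simp
    \<comment> \<open>All strings from stage \<open>j\<close> on are longer than
      \<open>poly p m\<close>.\<close>
    moreover have "q \<in> a \<longleftrightarrow> q \<in> A" if "length q \<le> poly p m" for q
    proof
      assume q: "q \<in> A"
      then obtain i where i: "q = x i" using A(2) by blast
      then have "i < j" using that reject(3) long[of i] by (cases "i < j") auto
      then show "q \<in> a" using q i by (simp add: a_def)
    qed (simp add: a_def)
    ultimately show False
      using accepts_within_cong_short[OF M(1)] reject(4) by metis
  next
    case accept
    \<comment> \<open>Every later stage still respects the pair \<open>(M, p)\<close>, so its string
      exceeds \<open>poly p (length (x j))\<close>.\<close>
    have "q \<in> A \<longleftrightarrow> q \<in> a" if q: "length q \<le> poly p (length (x j))" "q \<noteq> x j" for q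
    proof
      assume "q \<in> A"
      then obtain i where i: "q = x i" using A(2) by blast
      then have "i < j" using q polymono[of j i] j(1) by (cases i j rule: linorder_cases) auto
      then show "q \<in> a" using \<open>q \<in> A\<close> i by (auto simp: a_def)
    qed (simp add: a_def)
    with accept have "accepts_within M A (unary (length (x j))) (poly p (length (x j)))" by blast
    then have "unary (length (x j)) \<notin> length_lang A" using acc[of "unary (length (x j))"] by simp
    then show False using j(2) by (auto simp: length_lang_def)
  qed
qed

text \<open>All pairs of a machine and a polynomial are enumerated, possibly with repetitions, and
  the diagonal sequence is carried over to numbers. Below \<open>H\<close> the length language then
  lies in \<open>NP\<close> but not in \<open>coNP\<close>.\<close>

lemma ex_hereditarily_separating:
  "\<exists>H. infinite H \<and> (\<forall>K. infinite K \<and> K \<subseteq> H \<longrightarrow> NP_oracle K \<noteq> coNP_oracle K)"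
proof -
  let ?W = "{M. wf_otm M} \<times> (UNIV :: nat poly set)"
  define e where "e = from_nat_into ?W"
  have ne: "?W \<noteq> {}" using wf_guess_otm by blast
  have rng: "range e = ?W"
    unfolding e_def
    by (rule range_from_nat_into[OF ne]) (intro countable_SIGMA countable_wf_otm countable_UNIV_nat_poly)
  then have "wf_otm (fst (e i))" for i 
    using rangeI[of e i] by (auto simp: mem_Times_iff)
  then obtain x where x: "\<And>j. diagonalizes (x ` {..<j}) (e ` {..j}) (x j)"
    using ex_diagonal_sequence by blast
  have "strict_mono (\<lambda>j. length (x j))"
    using x by (intro strict_monoI) (auto simp: diagonalizes_def)
  then have "inj x" by (metis (mono_tags, lifting) injI strict_mono_eq)
  moreover have inj: "inj nat_of_str" using bij_nat_of_str by (rule bij_is_inj)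
  ultimately have "infinite (nat_of_str ` range x)"
    by (metis finite_imageD infinite_UNIV_nat inj_on_subset subset_UNIV)
  moreover have "NP_oracle K \<noteq> coNP_oracle K" if K: "infinite K" "K \<subseteq> nat_of_str ` range x" for K
  proof -
    have "K = nat_of_str ` strings_of K" using K(2) by (auto simp: strings_of_def)
    then have "infinite (strings_of K)" using K(1) by (metis finite_imageI)
    moreover have "strings_of K \<subseteq> range x"
      using K(2) inj_image_mem_iff[OF inj] unfolding strings_of_def by blast
    ultimately have "- length_lang (strings_of K) \<notin> NP_oracle K"
      using compl_length_lang_notin_NP_rel[of e x] x rng by blast
    then show ?thesis
      using length_lang_in_NP_rel[of "strings_of K"] by (auto simp: coNP_rel_def)
  qed
  ultimately show ?thesis by blast
qed


section \<open>The Ellentuck topology is Baire\<close>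

text \<open>For infinite \<open>S\<close> these sets form a neighbourhood base at \<open>S\<close>,
  with one numerical cutoff in place of a finite stem, which suits fusion.\<close>

definition ellentuck_nbhd :: "nat set \<Rightarrow> nat \<Rightarrow> nat set set" where
  "ellentuck_nbhd S m = {T. infinite T \<and> T \<subseteq> S \<and> T \<inter> {..<m} = S \<inter> {..<m}}"

lemma ellentuck_nbhd_antimono: "m \<le> n \<Longrightarrow> ellentuck_nbhd S n \<subseteq> ellentuck_nbhd S m"
  unfolding ellentuck_nbhd_def by fastforce

section \<open>Neighbourhoods and basic open sets\<close>

lemma mem_max_succ: "finite a \<Longrightarrow> i \<in> a \<Longrightarrow> i < max_succ a"
  by (auto simp: max_succ_def le_imp_less_Suc)

lemma ellentuck_nbhd_eq_basic: "ellentuck_nbhd S m = ellentuck_basic (S \<inter> {..<m}) (S - {..<m})"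
proof -
  \<comment> \<open>The two cutoffs may differ, but \<open>S\<close> has no element between
    them.\<close>
  have "max_succ (S \<inter> {..<m}) \<le> m"
    unfolding max_succ_def by (auto simp: Suc_le_eq)
  moreover have "i < max_succ (S \<inter> {..<m})" if "i \<in> S" "i < m" for i
    using mem_max_succ that by simp
  ultimately show ?thesis
    unfolding ellentuck_nbhd_def ellentuck_basic_def
    by (intro Collect_cong) (fastforce simp: set_eq_iff)
qed

lemma openin_ellentuck_nbhd:
  assumes "infinite S"
  shows "openin ellentuck (ellentuck_nbhd S m)"
proof -
  have "infinite (S - {..<m})" using assms by simp
  then show ?thesis
    unfolding ellentuck_def ellentuck_nbhd_eq_basic openin_topology_generated_by_iff
    by (intro generate_topology_on.Basis CollectI exI[of _ "S \<inter> {..<m}"] exI[of _ "S - {..<m}"]) auto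
qed

text \<open>For a basic set the cutoff \<open>max_succ a\<close> suffices: a subset of
  \<open>S\<close> agreeing with \<open>S\<close> below it has the same stem and stays inside
  \<open>A\<close> beyond it.\<close>

lemma openin_ellentuck_imp_nbhd:
  assumes "openin ellentuck U" and "S \<in> U"
  shows "\<exists>m. ellentuck_nbhd S m \<subseteq> U"
proof -
  have "generate_topology_on
     {ellentuck_basic a A | a A. finite a \<and> infinite A \<and> (\<forall>x\<in>a. \<forall>y\<in>A. x < y)} U"
    using assms(1) unfolding ellentuck_def openin_topology_generated_by_iff .
  then show ?thesis
    using assms(2)
  proof (induction rule: generate_topology_on.induct)
    case (Int U V)
    then obtain m n where "ellentuck_nbhd S m \<subseteq> U" "ellentuck_nbhd S n \<subseteq> V" by blast
    then have "ellentuck_nbhd S (max m n) \<subseteq> U \<inter> V"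
      using ellentuck_nbhd_antimono[of m "max m n" S] ellentuck_nbhd_antimono[of n "max m n" S] by auto
    then show ?case ..
  next
    case (UN \<U>)
    then show ?case by blast
  next
    case (Basis U)
    then obtain a A where "U = ellentuck_basic a A" by blast
    with Basis have "ellentuck_nbhd S (max_succ a) \<subseteq> U"
      by (auto simp: ellentuck_nbhd_def ellentuck_basic_def)
    then show ?case ..
  qed simp
qed

text \<open>Fusion: a decreasing sequence of infinite sets with growing frozen initial parts avoids
  \<open>N n\<close> at step \<open>n\<close>; its intersection is an infinite subset of
  \<open>H\<close> outside every \<open>N n\<close>.\<close>

lemma not_meager_in_ellentuck:
  assumes H: "infinite H" and sub: "\<And>K. infinite K \<Longrightarrow> K \<subseteq> H \<Longrightarrow> K \<in> X"
  shows "\<not> meager_in ellentuck X"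
proof
  assume "meager_in ellentuck X"
  then obtain N where N: "\<And>n. nowhere_dense_in ellentuck (N n)" and X: "X = (\<Union>n :: nat. N n)"
    unfolding meager_in_def by blast
  define good where "good n s = (infinite (fst s) \<and> fst s \<subseteq> H)" for n :: nat and s :: "nat set \<times> nat"
  \<comment> \<open>The element \<open>i\<close> is frozen by the new cutoff; one such element per
    step keeps the intersection infinite.\<close>
  define nxt where "nxt n s t \<longleftrightarrow> fst t \<in> ellentuck_nbhd (fst s) (snd s) \<and>
      ellentuck_nbhd (fst t) (snd t) \<inter> N n = {} \<and> (\<exists>i\<in>fst t. snd s \<le> i \<and> i < snd t) \<and> snd s \<le> snd t"
    for n and s t :: "nat set \<times> nat"
  have "\<exists>t. good (Suc n) t \<and> nxt n s t" if "good n s" for s n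
  proof -
    obtain S m where s: "s = (S, m)" by fastforce
    have S: "infinite S" "S \<subseteq> H" using that by (auto simp: good_def s)
    let ?C = "ellentuck closure_of N n"
    have "\<not> ellentuck_nbhd S m \<subseteq> ?C"
    proof
      assume "ellentuck_nbhd S m \<subseteq> ?C"
      then have "ellentuck_nbhd S m \<subseteq> ellentuck interior_of ?C"
        by (rule interior_of_maximal) (rule openin_ellentuck_nbhd[OF S(1)])
      moreover have "S \<in> ellentuck_nbhd S m" using S by (simp add: ellentuck_nbhd_def)
      ultimately show False using N[of n] by (auto simp: nowhere_dense_in_def)
    qed
    \<comment> \<open>\<open>T\<close> has a whole neighbourhood off the closure of
      \<open>N n\<close>, as the complement of the closure is open.\<close>
    then obtain T where T: "T \<in> ellentuck_nbhd S m" "T \<notin> ?C" by blast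
    then have iT: "infinite T" "T \<subseteq> S" by (auto simp: ellentuck_nbhd_def)
    have "openin ellentuck (topspace ellentuck - ?C)"
      by (intro openin_diff openin_topspace closedin_closure_of)
    moreover have "T \<in> topspace ellentuck - ?C" using T iT by (simp add: topspace_ellentuck)
    ultimately obtain k where k: "ellentuck_nbhd T k \<subseteq> topspace ellentuck - ?C"
      using openin_ellentuck_imp_nbhd by blast
    obtain i where i: "i \<in> T" "m \<le> i" using iT(1) by (meson infinite_nat_iff_unbounded_le)
    let ?l = "max k (Suc i)"
    have "N n \<subseteq> ?C" using N[of n] by (simp add: closure_of_subset nowhere_dense_in_def)
    then have "ellentuck_nbhd T ?l \<inter> N n = {}"
      using k ellentuck_nbhd_antimono[of k ?l T] by auto
    then have "nxt n s (T, ?l)" using T i by (auto simp: nxt_def s)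
    moreover have "good (Suc n) (T, ?l)" using iT S by (auto simp: good_def)
    ultimately show ?thesis by blast
  qed
  moreover have "good 0 (H, 0)" using H by (simp add: good_def)
  ultimately obtain s where s: "\<And>n. good n (s n)" "\<And>n. nxt n (s n) (s (Suc n))"
    using dependent_nat_choice[of good nxt] by metis
  define S m where "S n = fst (s n)" and "m n = snd (s n)" for n
  have step: "S (Suc n) \<subseteq> S n" "S (Suc n) \<inter> {..<m n} = S n \<inter> {..<m n}" "m n \<le> m (Suc n)"
      "\<exists>i\<in>S (Suc n). m n \<le> i \<and> i < m (Suc n)" "ellentuck_nbhd (S (Suc n)) (m (Suc n)) \<inter> N n = {}" for n
    using s(2)[of n] by (auto simp: nxt_def S_def m_def ellentuck_nbhd_def)
  have dec: "S n' \<subseteq> S n" if "n \<le> n'" for n n'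
    using step(1) that by (rule lift_Suc_antimono_le)
  have inc: "m n \<le> m n'" if "n \<le> n'" for n n'
    using step(3) that by (rule lift_Suc_mono_le)
  have stable: "S n' \<inter> {..<m n} = S n \<inter> {..<m n}" if "n \<le> n'" for n n'
    using that
  proof (induction rule: dec_induct)
    case (step k)
    then show ?case using inc[of n k] \<open>S (Suc k) \<inter> {..<m k} = S k \<inter> {..<m k}\<close> by fastforce
  qed simp
  define K where "K = (\<Inter>n. S n)"
  have K: "K \<inter> {..<m n} = S n \<inter> {..<m n}" for n
  proof -
    have "i \<in> S n'" if "i \<in> S n" "i < m n" for i n'
      using dec[of n' n] stable[of n n'] that by (cases "n \<le> n'") auto
    then show ?thesis by (auto simp: K_def)
  qed
  have "\<exists>i\<in>K. b \<le> i" for b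
  proof -
    have "b \<le> m b"
    proof (induction b)
      case (Suc b)
      then show ?case using step(4)[of b] by (metis Suc_leI le_less_trans)
    qed simp
    moreover obtain i where "i \<in> S (Suc b)" "m b \<le> i" "i < m (Suc b)" using step(4) by blast
    ultimately show ?thesis using K[of "Suc b"] by (metis IntD1 IntI le_trans lessThan_iff)
  qed
  then have inf: "infinite K" by (meson infinite_nat_iff_unbounded_le)
  have "K \<subseteq> H" using s(1)[of 0] by (auto simp: K_def S_def good_def)
  then have "K \<in> X" using sub inf by blast
  then obtain n where "K \<in> N n" using X by blast
  \<comment> \<open>\<open>K\<close> keeps the initial part frozen at this step and is a subset of
    \<open>S (Suc n)\<close>.\<close>
  moreover have "K \<in> ellentuck_nbhd (S (Suc n)) (m (Suc n))"
    using K[of "Suc n"] inf by (auto simp: ellentuck_nbhd_def K_def)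
  ultimately show False using step(5)[of n] by blast
qed

theorem theorem3p3:
  shows "ramsey_positive O' \<and>
    (\<exists>H :: nat set. infinite H \<and>
       (\<forall>K. infinite K \<and> K \<subseteq> H \<longrightarrow> NP_oracle K \<noteq> coNP_oracle K))"
proof -
  obtain H where H: "infinite H" "\<And>K. infinite K \<Longrightarrow> K \<subseteq> H \<Longrightarrow> NP_oracle K \<noteq> coNP_oracle K"
    using ex_hereditarily_separating by blast
  have "\<not> meager_in ellentuck O'"
    using not_meager_in_ellentuck[OF H(1)] H(2) by (simp add: O'_def)
  moreover have "O' \<subseteq> topspace ellentuck"
    by (auto simp: O'_def topspace_ellentuck)
  ultimately show ?thesis
    using H unfolding ramsey_positive_def ramsey_small_def by blast
qed

end
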